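(* Let $h,k\in\mathbb{C}$ with $k\ne0$. The sequence of moments $\mu_n=\mu_n(h,k)$ satisfies $\mu_0=1$, $\mu_1=h$, and for all $n\ge2$ $$\mu_n=\frac{h(2n+1)\mu_{n-1}-(h^2-4k)(n-1)\mu_{n-2}}{n+2}.$$
   Context: Let $Q_n(x)\in\mathbb{C}[x]$ be the monic polynomials defined by $Q_{-1}=0$, $Q_0=1$, $Q_n(x)=(x-h)Q_{n-1}(x)-kQ_{n-2}(x)$ for $n\ge1$. Since $k\neq 0$, by Favard's theorem there is a unique linear functional $\mathcal{V}:\mathbb{C}[x]\to\mathbb{C}$ with $\mathcal{V}[1]=1$ and $\mathcal{V}[Q_mQ_n]=0$ for $m\ne n$. The moments are $\mu_n(h,k)=\mathcal{V}[x^n]$. *)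

theory Defs
  imports Complex_Main "HOL-Computational_Algebra.Polynomial"
begin

text \<open>The indices are natural numbers, so the convention \<open>Q\<^sub>-\<^sub>1 = 0\<close> is built into the
  second equation: \<open>Q\<^sub>1 = (x - h) Q\<^sub>0 - k Q\<^sub>-\<^sub>1 = x - h\<close>.\<close>

fun Q :: "complex \<Rightarrow> complex \<Rightarrow> nat \<Rightarrow> complex poly" where
  "Q h k 0 = 1"
| "Q h k (Suc 0) = [:- h, 1:]"
| "Q h k (Suc (Suc n)) = [:- h, 1:] * Q h k (Suc n) - smult k (Q h k n)"

definition is_orthogonality_functional ::
    "complex \<Rightarrow> complex \<Rightarrow> (complex poly \<Rightarrow> complex) \<Rightarrow> bool" where
  "is_orthogonality_functional h k V \<longleftrightarrow>
     Vector_Spaces.linear smult (*) V \<and>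
     V 1 = 1 \<and>
     (\<forall>m n. m \<noteq> n \<longrightarrow> V (Q h k m * Q h k n) = 0)"

text \<open>For \<open>k \<noteq> 0\<close> the description below is proper: exactly one such functional exists, by
  Favard's theorem.\<close>

definition orthogonality_functional ::
    "complex \<Rightarrow> complex \<Rightarrow> complex poly \<Rightarrow> complex" where
  "orthogonality_functional h k = (THE V. is_orthogonality_functional h k V)"

definition moment :: "complex \<Rightarrow> complex \<Rightarrow> nat \<Rightarrow> complex" where
  "moment h k n = orthogonality_functional h k (monom 1 n)"

end

theory Submission
  imports Defs
begin

text \<open>For real \<open>h\<close> and positive \<open>k\<close> the functional \<open>V\<close> is a shifted and rescaled semicircle
  law: up to a constant it integrates against the weight \<open>w = sqrt (4 * k - (x - h)\<^sup>2)\<close>,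
  which solves the Pearson equation \<open>((x - h)\<^sup>2 - 4 * k) * w' = (x - h) * w\<close>. Integrating
  by parts turns this into the weight-free identity
  \<open>V (((x - h)\<^sup>2 - 4 * k) * p') + 3 * V ((x - h) * p) = 0\<close> for all polynomials \<open>p\<close>,
  and \<open>p = x ^ (n - 1)\<close> gives the recurrence.

  This identity has a purely algebraic proof, valid for complex \<open>h\<close> and \<open>k\<close>. A linear
  functional that vanishes on every \<open>Q n\<close> is zero (\<open>functional_zero_if_zero_on_Q\<close>),
  so the identity only has to be checked at \<open>p = Q n\<close>. There \<open>V\<close> picks out the coefficient of \<open>Q 0\<close>, and both terms are
  combinations of \<open>Q (n + 1)\<close> and \<open>Q (n - 1)\<close>: the second by the three-term recurrence, the
  first by a derivative formula (\<open>Q_derivative\<close>) of the kind known for Chebyshev polynomials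
  of the second kind.

  That \<open>V\<close> is well defined is Favard's theorem in this special case. Uniqueness is the spanning
  argument again. For existence, \<open>V p\<close> is taken to be the coefficient of \<open>Q 0\<close> in the
  expansion of \<open>p\<close> in the \<open>Q n\<close> (\<open>Q_coord\<close>), and orthogonality follows because
  multiplication by \<open>x\<close> can be moved from one factor of \<open>Q m * Q n\<close> to the other.\<close>

section \<open>Linear functionals and the spanning property\<close>

lemma linear_functional_iff:
  fixes F :: "'a::field poly \<Rightarrow> 'a"
  shows "Vector_Spaces.linear smult (*) F \<longleftrightarrow>
    (\<forall>p q. F (p + q) = F p + F q) \<and> (\<forall>c p. F (smult c p) = c * F p)"
proof -
  have "vector_space (smult :: 'a \<Rightarrow> 'a poly \<Rightarrow> 'a poly)"
    by unfold_locales (simp_all add: smult_add_left smult_add_right)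
  moreover have "vector_space ((*) :: 'a \<Rightarrow> 'a \<Rightarrow> 'a)"
    by unfold_locales (simp_all add: algebra_simps)
  ultimately show ?thesis
    by (auto simp: Vector_Spaces.linear_iff)
qed

lemma pCons_0_Q_0: "pCons 0 (Q h k 0) = Q h k 1 + smult h (Q h k 0)"
  by (simp add: one_pCons)

lemma pCons_0_Q_Suc:
  "pCons 0 (Q h k (Suc n)) =
     Q h k (Suc (Suc n)) + smult h (Q h k (Suc n)) + smult k (Q h k n)"
  by simp

text \<open>The three-term recurrence writes \<open>x * Q n\<close> as a combination of the \<open>Q m\<close>, so their span
  contains \<open>1 = Q 0\<close> and is closed under multiplication by \<open>x\<close>.\<close>

lemma functional_zero_if_zero_on_Q:
  fixes F :: "complex poly \<Rightarrow> complex"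
  assumes add: "\<And>p q. F (p + q) = F p + F q"
    and scale: "\<And>c p. F (smult c p) = c * F p"
    and Q: "\<And>n. F (Q h k n) = 0"
  shows "F p = 0"
proof -
  \<comment> \<open>Vanishing at all \<open>p * Q n\<close>, rather than only at \<open>p\<close>, is what survives an extra factor \<open>x\<close>.\<close>
  have "F (p * Q h k n) = 0" for n
  proof (induction p arbitrary: n)
    case 0
    show ?case using scale[of 0 0] by simp
  next
    case (pCons a p)
    have split: "pCons a p * Q h k n = smult a (Q h k n) + p * pCons 0 (Q h k n)"
      by simp
    have "F (p * pCons 0 (Q h k n)) = 0"
    proof (cases n)
      case 0
      then show ?thesis
        using pCons.IH[of 0] pCons.IH[of 1]
        unfolding 0 pCons_0_Q_0 by (simp only: distrib_left mult_smult_right add scale) simp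
    next
      case (Suc m)
      show ?thesis
        unfolding Suc pCons_0_Q_Suc
        by (simp only: distrib_left mult_smult_right add scale pCons.IH) simp
    qed
    then show ?case
      unfolding split by (simp add: add scale Q)
  qed
  from this[of 0] show ?thesis by simp
qed

section \<open>Existence and uniqueness of the orthogonality functional\<close>

text \<open>The matrix of multiplication by \<open>x\<close> in the basis \<open>Q 0, Q 1, \<dots>\<close> is tridiagonal; this is
  its action on coordinate sequences.\<close>

definition jacobi :: "complex \<Rightarrow> complex \<Rightarrow> (nat \<Rightarrow> complex) \<Rightarrow> nat \<Rightarrow> complex" where
  "jacobi h k f j = (if j = 0 then 0 else f (j - 1)) + h * f j + k * f (Suc j)"

text \<open>The coordinates of a polynomial in the basis \<open>Q 0, Q 1, \<dots>\<close>, computed by a Horner scheme: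
  they are \<open>p\<close> of the Jacobi operator, applied to the coordinates of \<open>1 = Q 0\<close>.\<close>

definition Q_coord :: "complex \<Rightarrow> complex \<Rightarrow> complex poly \<Rightarrow> nat \<Rightarrow> complex" where
  "Q_coord h k p =
     fold_coeffs (\<lambda>a f j. (if j = 0 then a else 0) + jacobi h k f j) p (\<lambda>_. 0)"

lemma Q_coord_0 [simp]: "Q_coord h k 0 j = 0"
  by (simp add: Q_coord_def)

lemma Q_coord_pCons:
  "Q_coord h k (pCons a p) j = (if j = 0 then a else 0) + jacobi h k (Q_coord h k p) j"
proof (cases "p = 0 \<and> a = 0")
  case True
  then show ?thesis by (simp add: Q_coord_def jacobi_def)
next
  case False
  then show ?thesis
    by (cases "a = 0") (simp_all add: Q_coord_def)
qed

lemma Q_coord_add: "Q_coord h k (p + q) j = Q_coord h k p j + Q_coord h k q j"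
  by (induction p q arbitrary: j rule: poly_induct2)
     (simp_all add: Q_coord_pCons jacobi_def algebra_simps)

lemma Q_coord_smult: "Q_coord h k (smult c p) j = c * Q_coord h k p j"
  by (induction p arbitrary: j) (simp_all add: Q_coord_pCons jacobi_def algebra_simps)

lemma Q_coord_diff: "Q_coord h k (p - q) j = Q_coord h k p j - Q_coord h k q j"
  using Q_coord_add[of h k "p - q" q j] by simp

lemma Q_coord_Q: "Q_coord h k (Q h k n) j = (if j = n then 1 else 0)"
proof (induction n arbitrary: j rule: induct_nat_012)
  case 0
  show ?case by (simp add: one_pCons Q_coord_pCons jacobi_def)
next
  case 1
  show ?case by (auto simp: Q_coord_pCons jacobi_def)
next
  case (ge2 n)
  have "Q h k (Suc (Suc n)) =
      pCons 0 (Q h k (Suc n)) - smult h (Q h k (Suc n)) - smult k (Q h k n)"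
    by simp
  then show ?case
    by (auto simp only: Q_coord_diff Q_coord_smult Q_coord_pCons jacobi_def ge2.IH)
       (auto split: if_splits)
qed

text \<open>Moving a factor \<open>x\<close> from \<open>Q m\<close> to \<open>Q n\<close> expresses the pairing of \<open>Q (m + 1)\<close> with \<open>Q n\<close>
  through pairings whose first index is at most \<open>m\<close>. Recording the value \<open>k ^ m\<close> on the diagonal
  is what lets the two surviving contributions at \<open>n = m - 1\<close> cancel in the induction.\<close>

lemma Q_coord_Q_mult_Q:
  "Q_coord h k (Q h k m * Q h k n) 0 = (if m = n then k ^ m else 0)"
proof (induction m arbitrary: n rule: induct_nat_012)
  case 0
  show ?case by (simp add: Q_coord_Q)
next
  case 1
  show ?case
  proof (cases n)
    case 0
    then show ?thesis using Q_coord_Q[of h k 1 0] by simp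
  next
    case (Suc i)
    have "Q h k (Suc 0) * Q h k n = Q h k (Suc n) + smult k (Q h k i)"
      unfolding Suc by simp
    then show ?thesis
      using Suc by (auto simp only: Q_coord_add Q_coord_smult Q_coord_Q) auto
  qed
next
  case (ge2 m)
  show ?case
  proof (cases n)
    case 0
    then show ?thesis
      using Q_coord_Q[of h k "Suc (Suc m)" 0] by simp
  next
    case (Suc i)
    have y: "[:- h, 1:] * Q h k n = Q h k (Suc n) + smult k (Q h k i)"
      unfolding Suc by simp
    have "Q h k (Suc (Suc m)) * Q h k n =
        Q h k (Suc m) * ([:- h, 1:] * Q h k n) - smult k (Q h k m * Q h k n)"
      by (simp add: algebra_simps)
    also have "\<dots> = Q h k (Suc m) * Q h k (Suc n) + smult k (Q h k (Suc m) * Q h k i)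
        - smult k (Q h k m * Q h k n)"
      unfolding y by (simp only: distrib_left mult_smult_right)
    finally show ?thesis
      using Suc by (simp only: Q_coord_add Q_coord_diff Q_coord_smult ge2.IH) auto
  qed
qed

lemma Q_coord_is_orthogonality_functional:
  "is_orthogonality_functional h k (\<lambda>p. Q_coord h k p 0)"
  unfolding is_orthogonality_functional_def linear_functional_iff
  using Q_coord_Q[of h k 0 0]
  by (simp add: Q_coord_add Q_coord_smult Q_coord_Q_mult_Q)

lemma is_orthogonality_functionalD:
  assumes "is_orthogonality_functional h k V"
  shows "V (p + q) = V p + V q" "V (smult c p) = c * V p" "V 1 = 1"
    "V (Q h k (Suc n)) = 0"
proof -
  show "V (p + q) = V p + V q" "V (smult c p) = c * V p" "V 1 = 1"
    using assms by (simp_all add: is_orthogonality_functional_def linear_functional_iff)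
  have "V (Q h k 0 * Q h k (Suc n)) = 0"
    using assms unfolding is_orthogonality_functional_def by blast
  then show "V (Q h k (Suc n)) = 0" by simp
qed

lemma orthogonality_functional_unique:
  assumes "is_orthogonality_functional h k V" "is_orthogonality_functional h k W"
  shows "V = W"
proof
  fix p
  note V = is_orthogonality_functionalD[OF assms(1)]
  note W = is_orthogonality_functionalD[OF assms(2)]
  have "V p - W p = 0"
  proof (rule functional_zero_if_zero_on_Q[of "\<lambda>p. V p - W p" h k])
    show "V (Q h k n) - W (Q h k n) = 0" for n
      using V(3,4) W(3,4) by (cases n) (simp_all del: Q.simps(2,3))
  qed (simp_all add: V(1,2) W(1,2) algebra_simps)
  then show "V p = W p" by simp
qed

lemma orthogonality_functional:
  "is_orthogonality_functional h k (orthogonality_functional h k)"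
  unfolding orthogonality_functional_def
  by (rule theI[of _ "\<lambda>p. Q_coord h k p 0"])
     (auto intro: Q_coord_is_orthogonality_functional orthogonality_functional_unique)

section \<open>The Pearson identity\<close>

text \<open>This is the analogue of
  \<open>(x\<^sup>2 - 1) * U\<^sub>n' = n * x * U\<^sub>n - (n + 1) * U\<^sub>n\<^sub>-\<^sub>1\<close> for Chebyshev polynomials of the second
  kind, with \<open>x * U\<^sub>n\<close> expanded by the recurrence.\<close>

lemma Q_derivative:
  "([:- h, 1:]\<^sup>2 - [:4 * k:]) * pderiv (Q h k (Suc n)) =
     smult (of_nat n + 1) (Q h k (Suc (Suc n))) - smult ((of_nat n + 3) * k) (Q h k n)"
proof (induction n rule: induct_nat_012)
  case 0
  show ?case by (simp add: power2_eq_square pderiv_pCons one_pCons)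
next
  case 1
  show ?case
    by (simp add: power2_eq_square pderiv_pCons pderiv_diff pderiv_smult one_pCons
        algebra_simps)
next
  case (ge2 n)
  define y where "y = [:- h, 1:]"
  define K where "K = [:k:]"
  define N where "N = [:of_nat n :: complex:]"
  have smult_K: "smult k p = K * p" for p by (simp add: K_def)
  define A B C D E where "A = Q h k n" and "B = Q h k (Suc n)" and
    "C = Q h k (Suc (Suc n))" and "D = Q h k (Suc (Suc (Suc n)))" and
    "E = Q h k (Suc (Suc (Suc (Suc n))))"
  have rec: "C = y * B - K * A" "D = y * C - K * B" "E = y * D - K * C"
    by (simp_all add: A_def B_def C_def D_def E_def y_def smult_K del: mult_pCons_left)
  have "pderiv y = 1" by (simp add: y_def pderiv_pCons one_pCons)
  then have deriv: "pderiv D = C + y * pderiv C - K * pderiv B"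
    unfolding rec(2)
    by (simp add: pderiv_diff pderiv_mult K_def pderiv_smult pderiv_pCons algebra_simps)
  have IH1: "(y\<^sup>2 - 4 * K) * pderiv B = (N + 1) * C - (N + 3) * K * A"
    using ge2.IH(1)
    by (simp add: A_def B_def C_def y_def K_def N_def one_pCons numeral_poly algebra_simps
        smult_add_left del: Q.simps(2,3))
  have IH2: "(y\<^sup>2 - 4 * K) * pderiv C = (N + 2) * D - (N + 4) * K * B"
    using ge2.IH(2)
    by (simp add: A_def B_def C_def D_def y_def K_def N_def one_pCons numeral_poly algebra_simps
        smult_add_left del: Q.simps(2,3))
  have "(y\<^sup>2 - 4 * K) * pderiv D = (N + 3) * E - (N + 5) * K * C"
    using IH1 IH2 deriv rec by algebra
  then show ?case
    by (simp add: C_def D_def E_def y_def K_def N_def one_pCons numeral_poly algebra_simps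
        smult_add_left del: Q.simps(2,3))
qed

text \<open>At \<open>p = Q (n + 1)\<close> the left-hand side is
  \<open>V ((n + 4) * Q (n + 2) - n * k * Q n)\<close>; its second term has the factor \<open>n\<close> and so
  disappears in the one case, \<open>n = 0\<close>, where \<open>V (Q n)\<close> does not.\<close>

lemma pearson_identity:
  assumes "is_orthogonality_functional h k V"
  shows "V (([:- h, 1:]\<^sup>2 - [:4 * k:]) * pderiv p) + 3 * V ([:- h, 1:] * p) = 0"
proof -
  note V = is_orthogonality_functionalD[OF assms]
  have V_diff: "V (p - q) = V p - V q" for p q
    using V(1)[of "p - q" q] by simp
  show ?thesis
  proof (rule functional_zero_if_zero_on_Q[where F = "\<lambda>p. V (([:- h, 1:]\<^sup>2 - [:4 * k:]) * pderiv p)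
      + 3 * V ([:- h, 1:] * p)" and h = h and k = k])
    show "V (([:- h, 1:]\<^sup>2 - [:4 * k:]) * pderiv (Q h k n)) + 3 * V ([:- h, 1:] * Q h k n) = 0"
      for n
    proof (cases n)
      case 0
      have "V 0 = 0" using V(2)[of 0 0] by simp
      then show ?thesis using V(4)[of 0] by (simp add: 0)
    next
      case (Suc m)
      have "[:- h, 1:] * Q h k (Suc m) = Q h k (Suc (Suc m)) + smult k (Q h k m)"
        by simp
      then show ?thesis
        unfolding Suc Q_derivative using V(4)
        by (cases m) (simp_all only: V_diff V(1,2), simp_all add: algebra_simps)
    qed
  qed (simp_all only: pderiv_add pderiv_smult distrib_left mult_smult_right V,
      simp_all only: add_ac mult_ac)
qed

section \<open>The recurrence for the moments\<close>

theorem theorem5p1: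
  fixes h k :: complex
  assumes "k \<noteq> 0"
  shows "moment h k 0 = 1 \<and>
         moment h k 1 = h \<and>
         (\<forall>n\<ge>2. moment h k n =
            (h * (2 * of_nat n + 1) * moment h k (n - 1)
              - (h\<^sup>2 - 4 * k) * (of_nat n - 1) * moment h k (n - 2))
            / (of_nat n + 2))"
proof (intro conjI allI impI)
  define V where "V = orthogonality_functional h k"
  have orth: "is_orthogonality_functional h k V"
    unfolding V_def by (rule orthogonality_functional)
  note V = is_orthogonality_functionalD[OF orth]
  have moment: "moment h k n = V (monom 1 n)" for n
    by (simp add: moment_def V_def)
  show "moment h k 0 = 1"
    using V(3) by (simp add: moment monom_0 one_pCons)
  have "monom 1 1 = Q h k (Suc 0) + smult h 1"
    by (simp add: monom_altdef one_pCons)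
  then show "moment h k 1 = h"
    using V(1-3) V(4)[of 0] by (simp only: moment) simp
  fix n :: nat
  assume "n \<ge> 2"
  then obtain m where n: "n = m + 2"
    using le_Suc_ex by (metis add.commute)
  have "pderiv (monom (1 :: complex) (m + 1)) = smult (of_nat m + 1) (monom 1 m)"
    by (simp only: pderiv_monom smult_monom) simp
  moreover have "([:- h, 1:]\<^sup>2 - [:4 * k:]) * monom 1 m =
      monom 1 (m + 2) + smult (- 2 * h) (monom 1 (m + 1)) + smult (h\<^sup>2 - 4 * k) (monom 1 m)"
    by (simp add: power2_eq_square monom_Suc smult_diff_left smult_diff_right algebra_simps
        del: smult_monom)
  ultimately have first: "([:- h, 1:]\<^sup>2 - [:4 * k:]) * pderiv (monom 1 (m + 1)) =
      smult (of_nat m + 1) (monom 1 (m + 2) + smult (- 2 * h) (monom 1 (m + 1))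
        + smult (h\<^sup>2 - 4 * k) (monom 1 m))"
    by (simp only: mult_smult_right)
  have second: "[:- h, 1:] * monom 1 (m + 1) = monom 1 (m + 2) + smult (- h) (monom 1 (m + 1))"
    by (simp add: monom_Suc)
  have "(of_nat m + 1) * (moment h k (m + 2) - 2 * h * moment h k (m + 1)
      + (h\<^sup>2 - 4 * k) * moment h k m) + 3 * (moment h k (m + 2) - h * moment h k (m + 1)) = 0"
    using pearson_identity[OF orth, of "monom 1 (m + 1)"]
    unfolding first second V(1,2) moment by simp
  then have rec: "(of_nat m + 4) * moment h k (m + 2) =
      h * (2 * of_nat m + 5) * moment h k (m + 1)
        - (h\<^sup>2 - 4 * k) * (of_nat m + 1) * moment h k m"
    by algebra
  have "(of_nat m + 4 :: complex) = of_nat (m + 4)" by simp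
  then have "(of_nat m + 4 :: complex) \<noteq> 0"
    by (simp only: of_nat_eq_0_iff)
  then show "moment h k n =
      (h * (2 * of_nat n + 1) * moment h k (n - 1)
        - (h\<^sup>2 - 4 * k) * (of_nat n - 1) * moment h k (n - 2)) / (of_nat n + 2)"
    using rec by (simp add: n eq_divide_eq algebra_simps)
qed

end
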